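(* Let $\phi:\mathbb D_\phi\subset\mathbb D\to\mathbb E$ be Hadamard differentiable uniformly in $\rho\in\mathbb D_\rho\subset\mathbb D_\phi$ tangentially to $\mathbb D_0$ with derivative map $\phi'_\rho$. Let $\hat\rho_{n,P}$ be a sequence of stochastic processes taking values in $\mathbb D_\phi$, where each $\hat\rho_{n,P}$ is an estimator of the parameter $\rho_P\in\mathbb D_\rho$. Suppose there exists a sequence of constants $r_n\to\infty$ such that $Z_{n,P}=r_n(\hat\rho_{n,P}-\rho_P)\rightsquigarrow Z_P$ in $\mathbb D$ uniformly in $P\in\mathcal P_n$. The limit process $Z_P$ is separable and takes its values in $\mathbb D_0$ for all $P\in\mathcal P=\bigcup_{n\ge n_0}\mathcal P_n$, where $n_0$ is fixed. Moreover, the set of stochastic processes $\{Z_P:P\in\mathcal P\}$ is relatively compact in the topology of weak convergence in $\mathbb D_0$, that is, every sequence in this set can be split into weakly convergent subsequences. Then $$r_n\big(\phi(\hat\rho_{n,P})-\phi(\rho_P)\big)\rightsquigarrow\phi'_{\rho_P}(Z_P)\quad\text{in }\mathbb E\text{ uniformly in }P\in\mathcal P_n .$$ If $(\rho,h)\mapsto\phi'_\rho(h)$ is defined and continuous on the whole of $\mathbb D_\rho\times\mathbb D$, then $r_n(\phi(\hat\rho_{n,P})-\phi(\rho_P))-\phi'_{\rho_P}(r_n(\hat\rho_{n,P}-\rho_P))$ converges to zero in outer probability uniformly in $P\in\mathcal P_n$. Moreover, the set of stochastic processes $\{\phi'_{\rho_P}(Z_P):P\in\mathcal P\}$ is relatively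 compact in the topology of weak convergence in $\mathbb E$.
   Context: **Convergence.** $X_{n,P}\rightsquigarrow Y_P$ in a normed space $\mathbb D$ uniformly in $P\in\mathcal P_n$ means $\sup_{P\in\mathcal P_n}\sup_{h\in\mathrm{BL}_1(\mathbb D)}|\mathrm E_P^*h(X_{n,P})-\mathrm E_Ph(Y_P)|\to0$, where $\mathrm{BL}_1(\mathbb D)$ is the set of functions $\mathbb D\to[0,1]$ with Lipschitz norm at most 1 and $\mathrm E_P^*$ is outer expectation. Convergence to zero in outer probability uniformly in $P\in\mathcal P_n$: for every $K>0$, $\sup_{P\in\mathcal P_n}\Pr_P^*(\|X_{n,P}\|>K)\to0$. **Uniform Hadamard differentiability.** $\mathbb D,\mathbb E$ are normed spaces, $\mathbb D_\phi\subset\mathbb D$, $\mathbb D_0\subset\mathbb D$ is a normed space, and $\mathbb D_\rho\subset\mathbb D_\phi$ is a compact metric space (its metric may differ from, e.g. be stronger than, that induced by the norm of $\mathbb D$). $\phi:\mathbb D_\phi\to\mathbb E$ is Hadamard differentiable uniformly in $\rho\in\mathbb D_\rho$ tangentially to $\mathbb D_0$ with derivative map $h\mapsto\phi'_\rho(h)$ if $$\Big|\frac{\phi(\rho_n+t_nh_n)-\phi(\rho_n)}{t_n}-\phi'_\rho(h)\Big|\to0,\qquad|\phi'_{\rho_n}(h_n)-\phi'_\rho(h)|\to0,\qquad n\to\infty,$$ for all convergent sequences $\rho_n\to\rho$ in $\mathbb D_\rho$, $t_n\to0$ in $\mathbb R$, and $h_n\to h\in\mathbb D_0$ in $\mathbb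 D$ such that $\rho_n+t_nh_n\in\mathbb D_\phi$ for every $n$ (the second requirement expresses continuity of $(\rho,h)\mapsto\phi'_\rho(h)$, from $\mathbb D_\rho\times\mathbb D_0$ to $\mathbb E$, at each point). As part of the definition, $h\mapsto\phi'_\rho(h)$ from $\mathbb D_0$ to $\mathbb E$ is linear for each $\rho\in\mathbb D_\rho$. *)

theory Defs
  imports "HOL-Probability.Probability"
begin

text \<open>
  Since only bounded functions \<open>f\<close> occur below, it makes no difference to the infimum that the
  measurable majorants are real-valued and integrable rather than extended-real-valued with an
  existing expectation. Majorants are pointwise on the sample space, and \<open>f\<close> need not be measurable.
\<close>

definition outer_expectation :: "'w measure \<Rightarrow> ('w \<Rightarrow> real) \<Rightarrow> real" where
  "outer_expectation M f =
     Inf {integral\<^sup>L M U | U. integrable M U \<and> (\<forall>\<omega>\<in>space M. f \<omega> \<le> U \<omega>)}"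

text \<open>
  In what follows a set \<open>S\<close> of the ambient type, with the induced metric and Borel sets, plays the
  role of the space in which weak convergence takes place. Only the values on \<open>S\<close> of a test
  function are constrained, so for \<open>S\<close>-valued maps these are exactly the functions on \<open>S\<close>.
\<close>

definition BL1 :: "'d::metric_space set \<Rightarrow> ('d \<Rightarrow> real) set" where
  "BL1 S = {h. h ` S \<subseteq> {0..1} \<and> 1-lipschitz_on S h}"

text \<open>Suprema are taken in \<^typ>\<open>ennreal\<close>, where the supremum of the empty set is \<open>0\<close>.\<close>

definition BL_deviation ::
  "'d::metric_space set \<Rightarrow> 'w measure \<Rightarrow> ('w \<Rightarrow> 'd) \<Rightarrow> 'v measure \<Rightarrow> ('v \<Rightarrow> 'd) \<Rightarrow> ennreal" where
  "BL_deviation S M X N Y =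
     (SUP h\<in>BL1 S. ennreal \<bar>outer_expectation M (\<lambda>\<omega>. h (X \<omega>)) - integral\<^sup>L N (\<lambda>\<omega>. h (Y \<omega>))\<bar>)"

text \<open>
  The index \<open>P\<close> stands for a probability law; \<open>M n P\<close> is the probability space on which \<open>X n P\<close> is
  defined and \<open>N P\<close> the one on which the limit \<open>Y P\<close> is defined. The maps \<open>X n P\<close> may be
  non-measurable. The first conjunct makes the expectations \<open>E\<^sub>P h(Y\<^sub>P)\<close> meaningful, since the
  Bochner integral of a non-measurable function is \<open>0\<close> by convention.
\<close>

definition weak_conv_uniformly ::
  "(nat \<Rightarrow> 'p \<Rightarrow> 'w measure) \<Rightarrow> (nat \<Rightarrow> 'p \<Rightarrow> 'w \<Rightarrow> 'd::real_normed_vector) \<Rightarrow>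
   ('p \<Rightarrow> 'v measure) \<Rightarrow> ('p \<Rightarrow> 'v \<Rightarrow> 'd) \<Rightarrow> (nat \<Rightarrow> 'p set) \<Rightarrow> bool" where
  "weak_conv_uniformly M X N Y \<P> \<longleftrightarrow>
     (\<forall>\<^sub>F n in sequentially. \<forall>P\<in>\<P> n. Y P \<in> borel_measurable (N P)) \<and>
     (\<lambda>n. SUP P\<in>\<P> n. BL_deviation UNIV (M n P) (X n P) (N P) (Y P)) \<longlonglongrightarrow> 0"

definition outer_prob_null_uniformly ::
  "(nat \<Rightarrow> 'p \<Rightarrow> 'w measure) \<Rightarrow> (nat \<Rightarrow> 'p \<Rightarrow> 'w \<Rightarrow> 'd::real_normed_vector) \<Rightarrow>
   (nat \<Rightarrow> 'p set) \<Rightarrow> bool" where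
  "outer_prob_null_uniformly M X \<P> \<longleftrightarrow>
     (\<forall>K>0. (\<lambda>n. SUP P\<in>\<P> n. outer_measure_of (M n P) {\<omega> \<in> space (M n P). norm (X n P \<omega>) > K})
              \<longlonglongrightarrow> 0)"

text \<open>The law of \<open>Y\<close> is a separable Borel measure: it is concentrated on a separable Borel set.\<close>

definition separable_random_element :: "'v measure \<Rightarrow> ('v \<Rightarrow> 'd::real_normed_vector) \<Rightarrow> bool" where
  "separable_random_element N Y \<longleftrightarrow>
     Y \<in> borel_measurable N \<and>
     (\<exists>S. S \<in> sets borel \<and> separable_space (top_of_set S) \<and> (AE \<omega> in N. Y \<omega> \<in> S))"

text \<open>
  Weak limits are Borel probability measures \<open>L\<close> on the subspace \<open>S\<close>, represented by the identity
  map on \<open>S\<close>; in particular \<open>space L = S\<close>, and the limit has to live in \<open>S\<close>.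
\<close>

definition weakly_relatively_compact ::
  "'d::real_normed_vector set \<Rightarrow> 'p set \<Rightarrow> ('p \<Rightarrow> 'v measure) \<Rightarrow> ('p \<Rightarrow> 'v \<Rightarrow> 'd) \<Rightarrow> bool" where
  "weakly_relatively_compact S \<P> N Y \<longleftrightarrow>
     (\<forall>P\<in>\<P>. Y P \<in> measurable (N P) (restrict_space borel S)) \<and>
     (\<forall>p :: nat \<Rightarrow> 'p. range p \<subseteq> \<P> \<longrightarrow>
        (\<exists>s :: nat \<Rightarrow> nat. strict_mono s \<and>
          (\<exists>L. prob_space L \<and> sets L = sets (restrict_space borel S) \<and>
               (\<lambda>k. BL_deviation S (N (p (s k))) (Y (p (s k))) L (\<lambda>x. x)) \<longlonglongrightarrow> 0)))"

text \<open>
  The parameter set \<open>Drho\<close> carries its own metric \<open>drho\<close>, unrelated to the norm. The maps \<open>\<phi>\<close> and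
  \<open>\<phi>' \<rho>\<close> matter only on \<open>Dphi\<close> and \<open>D0\<close>, respectively. The difference quotient
  requires \<open>t n \<noteq> 0\<close>, and its directions \<open>h n\<close> range over the whole ambient space.
\<close>

definition hadamard_differentiable_uniformly ::
  "'d::real_normed_vector set \<Rightarrow> 'd set \<Rightarrow> ('d \<Rightarrow> 'd \<Rightarrow> real) \<Rightarrow> 'd set \<Rightarrow>
   ('d \<Rightarrow> 'e::real_normed_vector) \<Rightarrow> ('d \<Rightarrow> 'd \<Rightarrow> 'e) \<Rightarrow> bool" where
  "hadamard_differentiable_uniformly Dphi Drho drho D0 \<phi> \<phi>' \<longleftrightarrow>
     (\<forall>\<rho>\<in>Drho. \<forall>x\<in>D0. \<forall>y\<in>D0. \<forall>a b. \<phi>' \<rho> (a *\<^sub>R x + b *\<^sub>R y) = a *\<^sub>R \<phi>' \<rho> x + b *\<^sub>R \<phi>' \<rho> y) \<and>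
     (\<forall>\<rho>s \<rho> t hs h.
        range \<rho>s \<subseteq> Drho \<and> limitin (Metric_space.mtopology Drho drho) \<rho>s \<rho> sequentially \<and>
        (\<forall>n::nat. t n \<noteq> (0::real)) \<and> t \<longlonglongrightarrow> 0 \<and> h \<in> D0 \<and> hs \<longlonglongrightarrow> h \<and>
        (\<forall>n. \<rho>s n + t n *\<^sub>R hs n \<in> Dphi)
        \<longrightarrow> (\<lambda>n. (\<phi> (\<rho>s n + t n *\<^sub>R hs n) - \<phi> (\<rho>s n)) /\<^sub>R t n) \<longlonglongrightarrow> \<phi>' \<rho> h) \<and>
     (\<forall>\<rho>s \<rho> hs h.
        range \<rho>s \<subseteq> Drho \<and> limitin (Metric_space.mtopology Drho drho) \<rho>s \<rho> sequentially \<and>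
        range hs \<subseteq> D0 \<and> h \<in> D0 \<and> hs \<longlonglongrightarrow> h
        \<longrightarrow> (\<lambda>n::nat. \<phi>' (\<rho>s n) (hs n)) \<longlonglongrightarrow> \<phi>' \<rho> h)"

end

theory Submission
  imports Defs
begin

text \<open>
  If uniform convergence failed, it would fail along some sequence \<open>P\<^sub>n \<in> \<P> n\<close>. Along a subsequence,
  the \<open>Z\<close> at \<open>P\<^sub>n\<close> converge weakly to a law \<open>L\<close> on \<open>D0\<close>, and \<open>\<rho> P\<^sub>n\<close> converges to some \<open>q\<close> in the
  compact metric space \<open>Drho\<close>. Uniform Hadamard differentiability says that the rescaled increments
  of \<open>\<phi>\<close> at \<open>\<rho> P\<^sub>n\<close>, as well as the derivatives \<open>\<phi>' (\<rho> P\<^sub>n)\<close>, converge continuously to \<open>\<phi>' q\<close>, so by an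
  extended continuous mapping theorem both sides of the claim have the same limit, the image of
  \<open>L\<close> under \<open>\<phi>' q\<close>. The remainder in the second claim converges continuously to \<open>0\<close>.
\<close>

section \<open>Outer expectation\<close>

text \<open>\<open>Inf\<close> on the reals is informative only for sets bounded below;
  \<open>0 \<le> f\<close> makes 0 a lower bound for the integrals of majorants.\<close>

lemma outer_expectation_le:
  assumes "integrable M U" "\<And>\<omega>. \<omega> \<in> space M \<Longrightarrow> 0 \<le> f \<omega>" "\<And>\<omega>. \<omega> \<in> space M \<Longrightarrow> f \<omega> \<le> U \<omega>"
  shows "outer_expectation M f \<le> integral\<^sup>L M U"
  unfolding outer_expectation_def
proof (rule cInf_lower)
  have "0 \<le> integral\<^sup>L M V" if "\<forall>\<omega>\<in>space M. f \<omega> \<le> V \<omega>" for V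
    using that assms(2) by (intro Bochner_Integration.integral_nonneg) (blast intro: order_trans)
  then show "bdd_below {integral\<^sup>L M U |U. integrable M U \<and> (\<forall>\<omega>\<in>space M. f \<omega> \<le> U \<omega>)}"
    by (intro bdd_belowI[of _ 0]) blast
qed (use assms in blast)

text \<open>The bound \<open>c\<close> supplies a constant majorant, integrable on a probability
  space, so the infimum is over a nonempty set.\<close>

lemma outer_expectation_greatest:
  assumes "prob_space M" "\<And>\<omega>. \<omega> \<in> space M \<Longrightarrow> f \<omega> \<le> c"
    and "\<And>U. integrable M U \<Longrightarrow> (\<And>\<omega>. \<omega> \<in> space M \<Longrightarrow> f \<omega> \<le> U \<omega>) \<Longrightarrow> a \<le> integral\<^sup>L M U"
  shows "a \<le> outer_expectation M f"
  unfolding outer_expectation_def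
proof (rule cInf_greatest)
  interpret prob_space M by fact
  have "integrable M (\<lambda>_. c)" by simp
  then show "{integral\<^sup>L M U |U. integrable M U \<and> (\<forall>\<omega>\<in>space M. f \<omega> \<le> U \<omega>)} \<noteq> {}"
    using assms(2) by blast
qed (use assms(3) in blast)

lemma outer_expectation_eq_integral:
  assumes "prob_space M" "f \<in> borel_measurable M" "\<And>\<omega>. \<omega> \<in> space M \<Longrightarrow> f \<omega> \<in> {0..c}"
  shows "outer_expectation M f = integral\<^sup>L M f"
proof (rule antisym)
  interpret prob_space M by fact
  have f: "integrable M f"
    by (rule integrable_const_bound[where B = c]) (use assms in \<open>auto intro!: AE_I2\<close>)
  then show "outer_expectation M f \<le> integral\<^sup>L M f"
    by (rule outer_expectation_le) (use assms in auto)
  show "integral\<^sup>L M f \<le> outer_expectation M f"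
    by (rule outer_expectation_greatest[where c = c])
      (use assms f in \<open>auto intro!: integral_mono\<close>)
qed

text \<open>Shifting a majorant of \<open>g\<close> by \<open>e\<close> gives a majorant of
  \<open>f\<close>.\<close>

lemma outer_expectation_le_add:
  assumes "prob_space M" "\<And>\<omega>. \<omega> \<in> space M \<Longrightarrow> 0 \<le> f \<omega>" "\<And>\<omega>. \<omega> \<in> space M \<Longrightarrow> g \<omega> \<le> c"
    and "\<And>\<omega>. \<omega> \<in> space M \<Longrightarrow> f \<omega> \<le> g \<omega> + e"
  shows "outer_expectation M f \<le> outer_expectation M g + e"
proof -
  interpret prob_space M by fact
  have "outer_expectation M f - e \<le> outer_expectation M g"
  proof (rule outer_expectation_greatest[where c = c])
    fix U assume U: "integrable M U" "\<And>\<omega>. \<omega> \<in> space M \<Longrightarrow> g \<omega> \<le> U \<omega>"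
    have "outer_expectation M f \<le> integral\<^sup>L M (\<lambda>\<omega>. U \<omega> + e)"
    proof (rule outer_expectation_le)
      show "f \<omega> \<le> U \<omega> + e" if "\<omega> \<in> space M" for \<omega>
        using U(2)[OF that] assms(4)[OF that] by linarith
    qed (use U assms in auto)
    also have "\<dots> = integral\<^sup>L M U + e" using U by (simp add: prob_space)
    finally show "outer_expectation M f - e \<le> integral\<^sup>L M U" by simp
  qed (use assms in auto)
  then show ?thesis by simp
qed

lemma outer_expectation_cmult:
  assumes "prob_space M" "\<And>\<omega>. \<omega> \<in> space M \<Longrightarrow> f \<omega> \<in> {0..b}" "0 < (c::real)"
  shows "outer_expectation M (\<lambda>\<omega>. c * f \<omega>) = c * outer_expectation M f"
proof -
  have le: "outer_expectation M (\<lambda>\<omega>. c * f \<omega>) \<le> c * outer_expectation M f"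
    if "0 < c" "\<And>\<omega>. \<omega> \<in> space M \<Longrightarrow> f \<omega> \<in> {0..b}" for c b :: real and f
  proof -
    have "outer_expectation M (\<lambda>\<omega>. c * f \<omega>) / c \<le> outer_expectation M f"
    proof (rule outer_expectation_greatest[OF \<open>prob_space M\<close>])
      fix U assume U: "integrable M U" "\<And>\<omega>. \<omega> \<in> space M \<Longrightarrow> f \<omega> \<le> U \<omega>"
      have "outer_expectation M (\<lambda>\<omega>. c * f \<omega>) \<le> integral\<^sup>L M (\<lambda>\<omega>. c * U \<omega>)"
        using U that by (intro outer_expectation_le) auto
      then show "outer_expectation M (\<lambda>\<omega>. c * f \<omega>) / c \<le> integral\<^sup>L M U"
        using \<open>0 < c\<close> by (simp add: field_simps)
    qed (use that in auto)
    then show ?thesis using \<open>0 < c\<close> by (simp add: field_simps)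
  qed
  \<comment> \<open>The inequality \<open>le\<close> for the factor \<open>inverse c\<close> and the
    function \<open>c * f\<close> yields the reverse direction.\<close>
  have "outer_expectation M (\<lambda>\<omega>. inverse c * (c * f \<omega>)) \<le> inverse c * outer_expectation M (\<lambda>\<omega>. c * f \<omega>)"
    by (rule le[where b = "c * b"]) (use assms in auto)
  moreover have "(\<lambda>\<omega>. inverse c * (c * f \<omega>)) = f" using \<open>0 < c\<close> by auto
  ultimately have "c * outer_expectation M f \<le> outer_expectation M (\<lambda>\<omega>. c * f \<omega>)"
    using \<open>0 < c\<close> by (simp add: field_simps)
  moreover have "outer_expectation M (\<lambda>\<omega>. c * f \<omega>) \<le> c * outer_expectation M f"
    using \<open>0 < c\<close> assms(2) by (rule le)
  ultimately show ?thesis by simp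
qed

text \<open>Markov's inequality for outer expectations: the superlevel set of an integrable majorant
  is measurable and covers \<open>A\<close>, so the ordinary inequality applies to it; then take the
  infimum over majorants.\<close>

lemma outer_measure_of_superlevel_le:
  assumes "prob_space M" "\<And>\<omega>. \<omega> \<in> space M \<Longrightarrow> f \<omega> \<in> {0..b}" "0 < c"
    and "A \<subseteq> {\<omega> \<in> space M. c \<le> f \<omega>}"
  shows "outer_measure_of M A \<le> ennreal (outer_expectation M f / c)"
proof -
  interpret prob_space M by fact
  have "measure M {\<omega>\<in>space M. c \<le> U \<omega>} * c \<le> integral\<^sup>L M U \<and>
      outer_measure_of M A \<le> ennreal (measure M {\<omega>\<in>space M. c \<le> U \<omega>})"
    if U: "integrable M U" "\<And>\<omega>. \<omega> \<in> space M \<Longrightarrow> f \<omega> \<le> U \<omega>" for U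
  proof
    have meas: "{\<omega>\<in>space M. c \<le> U \<omega>} \<in> sets M" using U(1) by measurable
    show "measure M {\<omega>\<in>space M. c \<le> U \<omega>} * c \<le> integral\<^sup>L M U"
      using integral_Markov_inequality_measure[OF U(1) sets.empty_sets AE_I2 \<open>0 < c\<close>] U(2) assms(2,3)
      by (force simp: field_simps)
    have "outer_measure_of M A \<le> outer_measure_of M {\<omega>\<in>space M. c \<le> U \<omega>}"
      using assms(4) U(2) by (intro outer_measure_of_mono) (auto intro: order_trans)
    with meas show "outer_measure_of M A \<le> ennreal (measure M {\<omega>\<in>space M. c \<le> U \<omega>})"
      by (simp add: emeasure_eq_measure)
  qed
  note U = this
  \<comment> \<open>\<open>enn2real\<close> sends infinity to 0, so finiteness is what lets the real
    bound below return to \<open>ennreal\<close>.\<close>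
  have fin: "outer_measure_of M A < \<infinity>"
  proof -
    have "outer_measure_of M A \<le> outer_measure_of M (space M)"
      using assms(4) by (intro outer_measure_of_mono) auto
    then show ?thesis by (simp add: emeasure_space_1 le_less_trans)
  qed
  have "enn2real (outer_measure_of M A) * c \<le> outer_expectation M f"
  proof (rule outer_expectation_greatest[OF \<open>prob_space M\<close>])
    fix V assume V: "integrable M V" "\<And>\<omega>. \<omega> \<in> space M \<Longrightarrow> f \<omega> \<le> V \<omega>"
    have "enn2real (outer_measure_of M A) \<le> measure M {\<omega>\<in>space M. c \<le> V \<omega>}"
      using U[OF V] by (intro enn2real_leI) auto
    then have "enn2real (outer_measure_of M A) * c \<le> measure M {\<omega>\<in>space M. c \<le> V \<omega>} * c"
      using assms(3) by simp
    with U[OF V] show "enn2real (outer_measure_of M A) * c \<le> integral\<^sup>L M V" by linarith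
  qed (use assms in auto)
  then have "enn2real (outer_measure_of M A) \<le> outer_expectation M f / c"
    using assms(3) by (simp add: field_simps)
  then show ?thesis using fin
    by (metis ennreal_enn2real ennreal_leI infinity_ennreal_def)
qed

section \<open>Bounded Lipschitz deviation\<close>

lemma BL1_UNIV_measurable: "h \<in> BL1 UNIV \<Longrightarrow> h \<in> borel_measurable borel"
  unfolding BL1_def by (auto intro!: borel_measurable_continuous_onI lipschitz_on_continuous_on)

lemma BL1_range: "h \<in> BL1 S \<Longrightarrow> x \<in> S \<Longrightarrow> h x \<in> {0..1}"
  unfolding BL1_def by blast

lemma BL_deviation_leI:
  assumes "\<And>h. h \<in> BL1 S \<Longrightarrow>
    \<bar>outer_expectation M (\<lambda>\<omega>. h (X \<omega>)) - integral\<^sup>L N (\<lambda>\<omega>. h (Y \<omega>))\<bar> \<le> e"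
  shows "BL_deviation S M X N Y \<le> ennreal e"
  unfolding BL_deviation_def by (intro SUP_least ennreal_leI assms)

lemma BL_deviation_leD:
  assumes "BL_deviation S M X N Y \<le> ennreal e" "0 \<le> e" "h \<in> BL1 S"
  shows "\<bar>outer_expectation M (\<lambda>\<omega>. h (X \<omega>)) - integral\<^sup>L N (\<lambda>\<omega>. h (Y \<omega>))\<bar> \<le> e"
proof -
  have "ennreal \<bar>outer_expectation M (\<lambda>\<omega>. h (X \<omega>)) - integral\<^sup>L N (\<lambda>\<omega>. h (Y \<omega>))\<bar> \<le> ennreal e"
    using assms(1,3) unfolding BL_deviation_def by (auto simp: SUP_le_iff)
  then show ?thesis using assms(2) by simp
qed

lemma BL1_mono: "S \<subseteq> T \<Longrightarrow> BL1 T \<subseteq> BL1 S"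
  unfolding BL1_def by (auto intro: lipschitz_on_subset)

text \<open>A larger space admits fewer test functions. This carries weak convergence in
  \<open>D0\<close> over to the ambient space.\<close>

lemma BL_deviation_mono: "S \<subseteq> T \<Longrightarrow> BL_deviation T M X N Y \<le> BL_deviation S M X N Y"
  unfolding BL_deviation_def by (intro SUP_subset_mono BL1_mono) auto

text \<open>Dividing by \<open>K\<close> makes \<open>F\<close> an admissible test function;
  \<open>1 \<le> K\<close> keeps its values in the unit interval.\<close>

lemma abs_expectation_diff_le_lipschitz:
  assumes "BL_deviation UNIV M X N Y \<le> ennreal e" "0 \<le> e" "prob_space M"
    and "K-lipschitz_on UNIV F" "1 \<le> K" "\<And>x. F x \<in> {0..1}"
  shows "\<bar>outer_expectation M (\<lambda>\<omega>. F (X \<omega>)) - integral\<^sup>L N (\<lambda>\<omega>. F (Y \<omega>))\<bar> \<le> K * e"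
proof -
  let ?h = "\<lambda>x. inverse K * F x"
  have "(inverse K * K)-lipschitz_on UNIV ?h"
    using assms(5) by (intro lipschitz_on_cmult_real_nonneg assms(4)) simp
  moreover have "?h x \<in> {0..1}" for x
    using assms(5) assms(6)[of x] mult_mono[of "inverse K" 1 "F x" 1] by (auto simp: field_simps)
  ultimately have h: "?h \<in> BL1 UNIV" using assms(5) unfolding BL1_def by auto
  have "outer_expectation M (\<lambda>\<omega>. ?h (X \<omega>)) = inverse K * outer_expectation M (\<lambda>\<omega>. F (X \<omega>))"
    by (rule outer_expectation_cmult[where b = 1]) (use assms in auto)
  then have "inverse K * (outer_expectation M (\<lambda>\<omega>. F (X \<omega>)) - integral\<^sup>L N (\<lambda>\<omega>. F (Y \<omega>)))
    = outer_expectation M (\<lambda>\<omega>. ?h (X \<omega>)) - integral\<^sup>L N (\<lambda>\<omega>. ?h (Y \<omega>))"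
    by (simp add: algebra_simps)
  then have "inverse K * \<bar>outer_expectation M (\<lambda>\<omega>. F (X \<omega>)) - integral\<^sup>L N (\<lambda>\<omega>. F (Y \<omega>))\<bar> \<le> e"
    using BL_deviation_leD[OF assms(1,2) h] assms(5) by (simp add: abs_mult[symmetric] flip: abs_mult_pos')
  then show ?thesis using assms(5) by (simp add: field_simps)
qed

text \<open>As \<open>Y\<close> is measurable, its outer expectations are integrals, so it can stand
  on either side of a deviation. The first inequality replaces the limit \<open>Y\<close> by
  \<open>W\<close>; the second compares \<open>X\<close> and \<open>Y\<close> through a common limit
  \<open>W\<close>.\<close>

lemma BL_deviation_triangle:
  fixes X :: "'w \<Rightarrow> 'd::metric_space"
  assumes "prob_space N" "Y \<in> borel_measurable N"
  shows "BL_deviation UNIV M X L W \<le> BL_deviation UNIV M X N Y + BL_deviation UNIV N Y L W"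
    and "BL_deviation UNIV M X N Y \<le> BL_deviation UNIV M X L W + BL_deviation UNIV N Y L W"
proof -
  have eq: "outer_expectation N (\<lambda>\<omega>. h (Y \<omega>)) = integral\<^sup>L N (\<lambda>\<omega>. h (Y \<omega>))" if "h \<in> BL1 UNIV" for h
    by (rule outer_expectation_eq_integral[OF assms(1), where c = 1])
      (use that assms(2) BL1_range[OF that] BL1_UNIV_measurable[OF that] in \<open>auto intro: measurable_compose\<close>)
  let ?a = "\<lambda>h. outer_expectation M (\<lambda>\<omega>. h (X \<omega>))" and ?b = "\<lambda>h. integral\<^sup>L N (\<lambda>\<omega>. h (Y \<omega>))"
    and ?c = "\<lambda>h. integral\<^sup>L L (\<lambda>\<omega>. h (W \<omega>))"
  have tri: "ennreal \<bar>x - z\<bar> \<le> ennreal \<bar>x - y\<bar> + ennreal \<bar>y - z\<bar>" for x y z :: real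
    by (simp flip: ennreal_plus)
  show "BL_deviation UNIV M X L W \<le> BL_deviation UNIV M X N Y + BL_deviation UNIV N Y L W"
    unfolding BL_deviation_def
  proof (rule SUP_least)
    fix h :: "'d \<Rightarrow> real" assume h: "h \<in> BL1 UNIV"
    have "ennreal \<bar>?a h - ?c h\<bar> \<le> ennreal \<bar>?a h - ?b h\<bar> + ennreal \<bar>outer_expectation N (\<lambda>\<omega>. h (Y \<omega>)) - ?c h\<bar>"
      unfolding eq[OF h] by (rule tri)
    also have "\<dots> \<le> (SUP h\<in>BL1 UNIV. ennreal \<bar>?a h - ?b h\<bar>)
        + (SUP h\<in>BL1 UNIV. ennreal \<bar>outer_expectation N (\<lambda>\<omega>. h (Y \<omega>)) - ?c h\<bar>)"
      by (intro add_mono SUP_upper h)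
    finally show "ennreal \<bar>?a h - ?c h\<bar> \<le> \<dots>" .
  qed
  show "BL_deviation UNIV M X N Y \<le> BL_deviation UNIV M X L W + BL_deviation UNIV N Y L W"
    unfolding BL_deviation_def
  proof (rule SUP_least)
    fix h :: "'d \<Rightarrow> real" assume h: "h \<in> BL1 UNIV"
    have "ennreal \<bar>?a h - ?b h\<bar> \<le> ennreal \<bar>?a h - ?c h\<bar> + ennreal \<bar>outer_expectation N (\<lambda>\<omega>. h (Y \<omega>)) - ?c h\<bar>"
      unfolding eq[OF h] using tri[of "?a h" "?b h" "?c h"] by (simp add: abs_minus_commute)
    also have "\<dots> \<le> (SUP h\<in>BL1 UNIV. ennreal \<bar>?a h - ?c h\<bar>)
        + (SUP h\<in>BL1 UNIV. ennreal \<bar>outer_expectation N (\<lambda>\<omega>. h (Y \<omega>)) - ?c h\<bar>)"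
      by (intro add_mono SUP_upper h)
    finally show "ennreal \<bar>?a h - ?b h\<bar> \<le> \<dots>" .
  qed
qed

section \<open>Extended continuous mapping\<close>

text \<open>Infimal convolution of \<open>f\<close> with \<open>K * dist\<close>, capped at 1.
  Points with \<open>K * dist y c \<ge> 1\<close> contribute at least 1, so a lower bound
  \<open>v \<le> 1\<close> for \<open>F y\<close> has to be checked only at points of
  \<open>A\<close> near \<open>y\<close>.\<close>

lemma lipschitz_envelope:
  fixes f :: "'d::metric_space \<Rightarrow> real"
  assumes "0 \<le> K" "\<And>c. c \<in> A \<Longrightarrow> 0 \<le> f c"
  obtains F where "K-lipschitz_on UNIV F" "\<And>y. F y \<in> {0..1}" "\<And>c. c \<in> A \<Longrightarrow> F c \<le> f c"
    "\<And>y v. v \<le> 1 \<Longrightarrow> (\<And>c. c \<in> A \<Longrightarrow> K * dist y c < 1 \<Longrightarrow> v \<le> f c) \<Longrightarrow> v \<le> F y"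
proof
  \<comment> \<open>The inserted 1 is the cap and also keeps \<open>T y\<close> nonempty if
    \<open>A\<close> is empty.\<close>
  define T where "T y = insert 1 ((\<lambda>c. f c + K * dist y c) ` A)" for y
  define F where "F y = Inf (T y)" for y
  have pos: "0 \<le> t" if "t \<in> T y" for t y using that assms by (auto simp: T_def)
  then have bdd: "bdd_below (T y)" for y by (meson bdd_belowI)
  have ne: "T y \<noteq> {}" for y by (simp add: T_def)
  show "F y \<in> {0..1}" for y
    using cInf_greatest[OF ne pos] cInf_lower[OF _ bdd, of 1 y] by (auto simp: F_def T_def)
  show "F c \<le> f c" if "c \<in> A" for c
    using cInf_lower[OF _ bdd, of "f c + K * dist c c" c] that by (force simp: F_def T_def)
  show "v \<le> F y" if "v \<le> 1" and *: "\<And>c. c \<in> A \<Longrightarrow> K * dist y c < 1 \<Longrightarrow> v \<le> f c" for y v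
    unfolding F_def
  proof (rule cInf_greatest[OF ne])
    fix t assume "t \<in> T y"
    then consider "t = 1" | c where "c \<in> A" "t = f c + K * dist y c" by (auto simp: T_def)
    then show "v \<le> t"
    proof cases
      case (2 c)
      show ?thesis
      proof (cases "K * dist y c < 1")
        case True
        then show ?thesis using 2 *[OF 2(1) True] assms(1) zero_le_dist[of y c]
          by (smt (verit) mult_nonneg_nonneg)
      next
        case False
        then show ?thesis using 2 assms(2)[OF 2(1)] that(1) by linarith
      qed
    qed (use that in simp)
  qed
  have le: "F x \<le> F y + K * dist x y" for x y
  proof -
    have "F x - K * dist x y \<le> Inf (T y)"
    proof (rule cInf_greatest[OF ne])
      fix t assume "t \<in> T y"
      then consider "t = 1" | c where "c \<in> A" "t = f c + K * dist y c" by (auto simp: T_def)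
      then show "F x - K * dist x y \<le> t"
      proof cases
        case 1
        have "F x \<le> 1" using cInf_lower[OF _ bdd, of 1 x] by (auto simp: F_def T_def)
        moreover have "0 \<le> K * dist x y" using assms(1) by simp
        ultimately show ?thesis using 1 by linarith
      next
        case (2 c)
        have "F x \<le> f c + K * dist x c"
          using cInf_lower[OF _ bdd, of "f c + K * dist x c" x] 2 by (auto simp: F_def T_def)
        moreover have "K * dist x c \<le> K * dist x y + K * dist y c"
          using mult_left_mono[OF dist_triangle[of x c y] assms(1)] by (simp add: algebra_simps)
        ultimately show ?thesis using 2 by linarith
      qed
    qed
    then show ?thesis by (simp add: F_def)
  qed
  show "K-lipschitz_on UNIV F"
  proof (rule lipschitz_onI)
    show "dist (F x) (F y) \<le> K * dist x y" for x y
      using le[of x y] le[of y x] by (simp add: dist_real_def dist_commute abs_le_iff)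
  qed (fact assms(1))
qed

text \<open>\<open>A\<close> may be non-measurable, but the set where \<open>G < F\<close> is
  measurable and misses \<open>A\<close>, so it has measure at most \<open>e\<close>; on it
  \<open>F\<close> exceeds \<open>G\<close> by at most 1.\<close>

lemma integral_le_of_le_on_large_outer_measure:
  fixes F G :: "'a \<Rightarrow> real"
  assumes "prob_space L" "F \<in> borel_measurable L" "G \<in> borel_measurable L"
    and "\<And>x. x \<in> space L \<Longrightarrow> F x \<in> {0..1}" "\<And>x. x \<in> space L \<Longrightarrow> G x \<in> {0..1}"
    and "A \<subseteq> space L" "\<And>x. x \<in> A \<Longrightarrow> F x \<le> G x" "ennreal (1 - e) \<le> outer_measure_of L A"
  shows "integral\<^sup>L L F \<le> integral\<^sup>L L G + e"
proof -
  interpret prob_space L by fact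
  let ?B = "{x \<in> space L. G x < F x}"
  have B: "?B \<in> sets L" using assms(2,3) by measurable
  have int: "integrable L F" "integrable L G"
    by (rule integrable_const_bound[where B = 1]; use assms in \<open>auto intro!: AE_I2\<close>)+
  have "integral\<^sup>L L F \<le> integral\<^sup>L L (\<lambda>x. G x + indicator ?B x)"
  proof (rule integral_mono)
    show "F x \<le> G x + indicator ?B x" if "x \<in> space L" for x
      using that assms(4)[OF that] assms(5)[OF that] by (auto simp: indicator_def)
    show "integrable L (\<lambda>x. G x + indicator ?B x)"
      using int B by (intro Bochner_Integration.integrable_add) (auto simp: emeasure_eq_measure)
  qed (fact int)
  also have "\<dots> = integral\<^sup>L L G + measure L ?B"
    using int B by (simp add: emeasure_eq_measure)
  also have "measure L ?B \<le> e"
  proof -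
    have "outer_measure_of L A \<le> outer_measure_of L (space L - ?B)"
      using assms(6,7) by (intro outer_measure_of_mono) force
    also have "\<dots> = ennreal (1 - measure L ?B)"
      using B by (simp add: sets.compl_sets emeasure_eq_measure prob_compl del: Diff_iff)
    finally have "ennreal (1 - e) \<le> ennreal (1 - measure L ?B)" using assms(8) by (rule order_trans[rotated])
    then show ?thesis by simp
  qed
  finally show ?thesis by simp
qed

lemma borel_measurable_subspace:
  assumes "sets L = sets (restrict_space borel S)" "continuous_on S f"
  shows "f \<in> borel_measurable L"
  using borel_measurable_continuous_on_restrict[OF assms(2)] assms(1)
  by (simp cong: measurable_cong_sets)

text \<open>Otherwise each \<open>m\<close> has a bad index \<open>\<sigma> m \<ge> m\<close> and a
  bad point within \<open>1 / (m + 1)\<close> of \<open>x\<close>, and these contradict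
  \<open>conv\<close>. The indices need not increase, which is why \<open>conv\<close> only asks
  that \<open>\<sigma>\<close> tend to infinity.\<close>

lemma continuously_convergent_uniformly_near:
  fixes gn :: "nat \<Rightarrow> 'd::metric_space \<Rightarrow> 'e::metric_space"
  assumes conv: "\<And>\<sigma> y. filterlim \<sigma> at_top sequentially \<Longrightarrow> (\<And>k. y k \<in> D (\<sigma> k)) \<Longrightarrow> y \<longlonglongrightarrow> x
      \<Longrightarrow> (\<lambda>k. gn (\<sigma> k) (y k)) \<longlonglongrightarrow> a"
    and "0 < e"
  shows "\<exists>m. \<forall>n\<ge>m. \<forall>y\<in>D n. real (Suc m) * dist y x < 1 \<longrightarrow> dist (gn n y) a < e"
proof (rule ccontr)
  assume "\<nexists>m. \<forall>n\<ge>m. \<forall>y\<in>D n. real (Suc m) * dist y x < 1 \<longrightarrow> dist (gn n y) a < e"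
  then obtain \<sigma> y where *: "\<And>m. \<sigma> m \<ge> m" "\<And>m. y m \<in> D (\<sigma> m)" "\<And>m. real (Suc m) * dist (y m) x < 1"
    "\<And>m. \<not> dist (gn (\<sigma> m) (y m)) a < e"
    by metis
  have "(\<lambda>m. dist (y m) x) \<longlonglongrightarrow> 0"
  proof (rule tendsto_sandwich[OF _ _ tendsto_const LIMSEQ_inverse_real_of_nat])
    show "\<forall>\<^sub>F m in sequentially. dist (y m) x \<le> inverse (real (Suc m))"
      using *(3) by (auto intro!: always_eventually less_imp_le simp: field_simps)
  qed auto
  then have "(\<lambda>k. gn (\<sigma> k) (y k)) \<longlonglongrightarrow> a"
    using * by (intro conv) (auto simp: tendsto_dist_iff[of y] intro: filterlim_at_top_mono[OF filterlim_ident])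
  then have "\<forall>\<^sub>F k in sequentially. dist (gn (\<sigma> k) (y k)) a < e"
    using \<open>0 < e\<close> by (rule tendstoD)
  with *(4) show False by simp
qed

text \<open>
  For a tolerance \<open>e\<close>, the limit points at which continuous convergence has set in by stage \<open>m\<close>,
  uniformly on a ball of radius \<open>1 / (m + 1)\<close>, increase to \<open>S\<close>; they need not be measurable, but outer
  measure is continuous from below. On them the Lipschitz envelope of \<open>h \<circ> g\<close> is at most
  \<open>h \<circ> g\<close>, while it dominates \<open>h \<circ> gn n - e\<close> on \<open>D n\<close> for \<open>n \<ge> m\<close>.
\<close>
lemma extended_continuous_mapping_BL:
  fixes gn :: "nat \<Rightarrow> 'd::metric_space \<Rightarrow> 'e::metric_space"
    and X :: "nat \<Rightarrow> 'w \<Rightarrow> 'd"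
  assumes prob: "\<And>k. prob_space (M k)" "prob_space L"
    and L: "sets L = sets (restrict_space borel S)"
    and X: "\<And>k. X k \<in> space (M k) \<rightarrow> D k"
    and dev: "(\<lambda>k. BL_deviation UNIV (M k) (X k) L (\<lambda>x. x)) \<longlonglongrightarrow> 0"
    and g: "continuous_on S g"
    and conv: "\<And>\<sigma> y x. filterlim \<sigma> at_top sequentially \<Longrightarrow> (\<And>k. y k \<in> D (\<sigma> k)) \<Longrightarrow> x \<in> S
      \<Longrightarrow> y \<longlonglongrightarrow> x \<Longrightarrow> (\<lambda>k. gn (\<sigma> k) (y k)) \<longlonglongrightarrow> g x"
  shows "(\<lambda>k. BL_deviation UNIV (M k) (\<lambda>\<omega>. gn k (X k \<omega>)) L g) \<longlonglongrightarrow> 0"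
proof (rule tendsto_zero_ennreal)
  fix r :: real assume "0 < r"
  \<comment> \<open>Three errors of size \<open>e\<close> add up in \<open>bound\<close>: from
    replacing \<open>gn\<close> by \<open>g\<close> at nearby points, from the deviation of
    \<open>X n\<close>, and from the points outside \<open>A m\<close>.\<close>
  define e where "e = min 1 (r / 4)"
  have e: "0 < e" "e \<le> 1" "3 * e < r" using \<open>0 < r\<close> by (auto simp: e_def)
  interpret L: prob_space L by fact
  have space_L: "space L = S"
    using sets_eq_imp_space_eq[OF L] by (simp add: space_restrict_space)
  define A where "A m = {c \<in> S. \<forall>n\<ge>m. \<forall>y\<in>D n. real (Suc m) * dist y c < 1 \<longrightarrow> dist (gn n y) (g c) < e}" for m
  have "incseq A"
  proof (rule incseq_SucI, rule subsetI)
    fix m c assume c: "c \<in> A m"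
    have "real (Suc m) * dist y c < 1" if "real (Suc (Suc m)) * dist y c < 1" for y
      using that by (simp add: algebra_simps) (smt (verit) zero_le_dist)
    then show "c \<in> A (Suc m)" using c unfolding A_def by (auto dest: Suc_leD)
  qed
  have Union_A: "(\<Union>m. A m) = space L"
  proof -
    have "\<exists>m. c \<in> A m" if "c \<in> S" for c
      using continuously_convergent_uniformly_near[where gn = gn and D = D, OF conv[OF _ _ that] e(1)] that
      unfolding A_def by blast
    then show ?thesis unfolding space_L by (auto simp: A_def)
  qed
  have AL: "A m \<subseteq> space L" for m by (auto simp: A_def space_L)
  have "(SUP m. outer_measure_of L (A m)) = 1"
    unfolding SUP_outer_measure_of_incseq[OF AL \<open>incseq A\<close>] Union_A
    by (simp add: L.emeasure_space_1)
  moreover have "ennreal (1 - e) < 1" using e by (simp add: ennreal_less_one_iff)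
  ultimately have "ennreal (1 - e) < (SUP m. outer_measure_of L (A m))" by simp
  then obtain m where m: "ennreal (1 - e) < outer_measure_of L (A m)"
    unfolding less_SUP_iff by blast
  define K where "K = real (Suc m)"
  have K: "1 \<le> K" "0 < e / K" using e by (auto simp: K_def)
  have meas_hg: "(\<lambda>x. h (g x)) \<in> borel_measurable L" if "h \<in> BL1 UNIV" for h
    using measurable_compose[OF borel_measurable_subspace[OF L g] BL1_UNIV_measurable[OF that]] .
  have meas_F: "F \<in> borel_measurable L" if "K-lipschitz_on UNIV F" for F :: "'d \<Rightarrow> real"
    using borel_measurable_subspace[OF L] lipschitz_on_continuous_on[OF that] continuous_on_subset by blast
  have h_close: "\<bar>h x - h y\<bar> \<le> e" if "h \<in> BL1 UNIV" "dist x y < e" for h and x y :: 'e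
    using lipschitz_onD[of 1 UNIV h x y] that unfolding BL1_def by (auto simp: dist_real_def)
  have bound: "\<bar>outer_expectation (M n) (\<lambda>\<omega>. h (gn n (X n \<omega>))) - integral\<^sup>L L (\<lambda>x. h (g x))\<bar> \<le> 3 * e"
    if n: "n \<ge> m" "BL_deviation UNIV (M n) (X n) L (\<lambda>x. x) \<le> ennreal (e / K)" and h: "h \<in> BL1 UNIV" for n h
  proof -
    have h01: "h y \<in> {0..1}" for y by (rule BL1_range[OF h]) simp
    have near: "dist (gn n (X n \<omega>)) (g c) < e"
      if "\<omega> \<in> space (M n)" "c \<in> A m" "K * dist (X n \<omega>) c < 1" for \<omega> c
      using that X[of n] n(1) unfolding A_def K_def by auto
    have K0: "0 \<le> K" using K by simp
    \<comment> \<open>Envelopes are \<open>K\<close>-Lipschitz, which costs a factor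
      \<open>K\<close>; the threshold \<open>e / K\<close> for the deviation turns this into an
      error \<open>e\<close>.\<close>
    note env = abs_expectation_diff_le_lipschitz[OF n(2) less_imp_le[OF K(2)] prob(1) _ K(1)]
    obtain F where F: "K-lipschitz_on UNIV F" "\<And>y. F y \<in> {0..1}" "\<And>c. c \<in> A m \<Longrightarrow> F c \<le> h (g c)"
      "\<And>y v. v \<le> 1 \<Longrightarrow> (\<And>c. c \<in> A m \<Longrightarrow> K * dist y c < 1 \<Longrightarrow> v \<le> h (g c)) \<Longrightarrow> v \<le> F y"
      using lipschitz_envelope[OF K0, of "A m" "\<lambda>c. h (g c)"] h01 by auto
    have "outer_expectation (M n) (\<lambda>\<omega>. h (gn n (X n \<omega>))) \<le> outer_expectation (M n) (\<lambda>\<omega>. F (X n \<omega>)) + e"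
    proof (rule outer_expectation_le_add[OF prob(1), where c = 1])
      fix \<omega> assume \<omega>: "\<omega> \<in> space (M n)"
      have "h (gn n (X n \<omega>)) - e \<le> F (X n \<omega>)"
      proof (rule F(4))
        show "h (gn n (X n \<omega>)) - e \<le> 1" using h01[of "gn n (X n \<omega>)"] e by auto
        show "h (gn n (X n \<omega>)) - e \<le> h (g c)" if "c \<in> A m" "K * dist (X n \<omega>) c < 1" for c
          using h_close[OF h near[OF \<omega> that]] by linarith
      qed
      then show "h (gn n (X n \<omega>)) \<le> F (X n \<omega>) + e" by simp
    qed (use F(2) h01 in auto)
    moreover have "outer_expectation (M n) (\<lambda>\<omega>. F (X n \<omega>)) \<le> integral\<^sup>L L F + e"
      using env[OF F(1,2)] K by simp
    moreover have "integral\<^sup>L L F \<le> integral\<^sup>L L (\<lambda>x. h (g x)) + e"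
      using F(2,3) h01 m by (intro integral_le_of_le_on_large_outer_measure[OF prob(2) meas_F[OF F(1)] meas_hg[OF h] _ _ AL])
        auto
    moreover
    \<comment> \<open>For the lower bound, \<open>1 - G\<close> with \<open>G\<close> the envelope
      of \<open>1 - h \<circ> g\<close> is used. Putting \<open>1 - h\<close> into the upper bound
      would not do, since the outer expectation of \<open>1 - f\<close> need not be 1 minus that of
      \<open>f\<close>.\<close>
    obtain G where G: "K-lipschitz_on UNIV G" "\<And>y. G y \<in> {0..1}" "\<And>c. c \<in> A m \<Longrightarrow> G c \<le> 1 - h (g c)"
      "\<And>y v. v \<le> 1 \<Longrightarrow> (\<And>c. c \<in> A m \<Longrightarrow> K * dist y c < 1 \<Longrightarrow> v \<le> 1 - h (g c)) \<Longrightarrow> v \<le> G y"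
      using lipschitz_envelope[OF K0, of "A m" "\<lambda>c. 1 - h (g c)"] h01 by auto
    have G': "K-lipschitz_on UNIV (\<lambda>x. 1 - G x)" "\<And>y. 1 - G y \<in> {0..1}"
      using G(1) G(2) by (auto simp: lipschitz_on_def dist_real_def abs_minus_commute)
    have "outer_expectation (M n) (\<lambda>\<omega>. 1 - G (X n \<omega>)) \<le> outer_expectation (M n) (\<lambda>\<omega>. h (gn n (X n \<omega>))) + e"
    proof (rule outer_expectation_le_add[OF prob(1), where c = 1])
      fix \<omega> assume \<omega>: "\<omega> \<in> space (M n)"
      have "1 - h (gn n (X n \<omega>)) - e \<le> G (X n \<omega>)"
      proof (rule G(4))
        show "1 - h (gn n (X n \<omega>)) - e \<le> 1" using h01[of "gn n (X n \<omega>)"] e by auto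
        show "1 - h (gn n (X n \<omega>)) - e \<le> 1 - h (g c)" if "c \<in> A m" "K * dist (X n \<omega>) c < 1" for c
          using h_close[OF h near[OF \<omega> that]] by linarith
      qed
      then show "1 - G (X n \<omega>) \<le> h (gn n (X n \<omega>)) + e" by simp
    qed (use G(2) h01 in auto)
    moreover have "integral\<^sup>L L (\<lambda>x. 1 - G x) \<le> outer_expectation (M n) (\<lambda>\<omega>. 1 - G (X n \<omega>)) + e"
      using env[OF G'] K by simp
    moreover have "integral\<^sup>L L (\<lambda>x. h (g x)) \<le> integral\<^sup>L L (\<lambda>x. 1 - G x) + e"
    proof (rule integral_le_of_le_on_large_outer_measure[OF prob(2) meas_hg[OF h] meas_F[OF G'(1)] _ _ AL])
      show "h (g c) \<le> 1 - G c" if "c \<in> A m" for c using G(3)[OF that] by simp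
    qed (use G'(2) h01 m in auto)
    ultimately show ?thesis by linarith
  qed
  have "\<forall>\<^sub>F n in sequentially. BL_deviation UNIV (M n) (X n) L (\<lambda>x. x) < ennreal (e / K)"
    using order_tendstoD(2)[OF dev] K(2) by simp
  then show "\<forall>\<^sub>F n in sequentially. BL_deviation UNIV (M n) (\<lambda>\<omega>. gn n (X n \<omega>)) L g < ennreal r"
    using eventually_ge_at_top[of m]
  proof eventually_elim
    case (elim n)
    have "BL_deviation UNIV (M n) (\<lambda>\<omega>. gn n (X n \<omega>)) L g \<le> ennreal (3 * e)"
      by (rule BL_deviation_leI, rule bound) (use elim in auto)
    also have "\<dots> < ennreal r" using e by (simp add: ennreal_lessI)
    finally show ?case .
  qed
qed

section \<open>The uniform delta method\<close>

lemma limitin_compose: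
  assumes "limitin X f l F" "filterlim g F G"
  shows "limitin X (\<lambda>x. f (g x)) l G"
  using assms eventually_compose_filterlim unfolding limitin_def by blast

lemma continuous_map_prod_tendsto:
  assumes "continuous_map (prod_topology X euclidean) euclidean (\<lambda>(q, h). f q h)"
    and "limitin X a q F" "(y \<longlongrightarrow> x) F"
  shows "((\<lambda>k. f (a k) (y k)) \<longlongrightarrow> f q x) F"
proof -
  have "limitin (prod_topology X euclidean) (\<lambda>k. (a k, y k)) (q, x) F"
    using assms(2,3) by (simp add: limitin_pairwise o_def)
  from continuous_map_limit[OF assms(1) this] show ?thesis
    by (simp add: o_def)
qed

text \<open>The norm truncated at 1 is a bounded Lipschitz test function vanishing at 0, so its
  outer expectations tend to 0 and the Markov bound applies.\<close>

lemma outer_prob_tendsto_0_if_BL_deviation: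
  fixes X :: "nat \<Rightarrow> 'w \<Rightarrow> 'e::real_normed_vector"
  assumes "\<And>k. prob_space (M k)" "(\<lambda>k. BL_deviation UNIV (M k) (X k) L (\<lambda>_. 0)) \<longlonglongrightarrow> 0" "0 < K"
  shows "(\<lambda>k. outer_measure_of (M k) {\<omega> \<in> space (M k). K < norm (X k \<omega>)}) \<longlonglongrightarrow> 0"
proof -
  define h where "h = (\<lambda>x::'e. min 1 (norm x))"
  have h: "h \<in> BL1 UNIV"
    unfolding BL1_def h_def lipschitz_on_def
    by (auto simp: dist_real_def dist_norm min_def abs_le_iff)
      (smt (verit) norm_triangle_ineq3 norm_minus_commute)+
  \<comment> \<open>The truncated norm never exceeds 1, so for \<open>K > 1\<close> the event can
    only be detected at level 1.\<close>
  define c where "c = min 1 K"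
  have c: "0 < c" "c \<le> 1" "c \<le> K" using assms(3) by (auto simp: c_def)
  show ?thesis
  proof (rule tendsto_zero_ennreal)
    fix e :: real assume "0 < e"
    have "\<forall>\<^sub>F k in sequentially. BL_deviation UNIV (M k) (X k) L (\<lambda>_. 0) < ennreal (e / 2 * c)"
      using assms(2) \<open>0 < e\<close> c by (intro order_tendstoD) auto
    then show "\<forall>\<^sub>F k in sequentially. outer_measure_of (M k) {\<omega> \<in> space (M k). K < norm (X k \<omega>)} < ennreal e"
    proof eventually_elim
      case (elim k)
      have "\<bar>outer_expectation (M k) (\<lambda>\<omega>. h (X k \<omega>)) - integral\<^sup>L L (\<lambda>\<omega>. h 0)\<bar> \<le> e / 2 * c"
        using elim \<open>0 < e\<close> c by (intro BL_deviation_leD[OF _ _ h]) auto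
      then have "outer_expectation (M k) (\<lambda>\<omega>. h (X k \<omega>)) / c \<le> e / 2"
        using c by (simp add: h_def field_simps)
      moreover have "outer_measure_of (M k) {\<omega> \<in> space (M k). K < norm (X k \<omega>)}
          \<le> ennreal (outer_expectation (M k) (\<lambda>\<omega>. h (X k \<omega>)) / c)"
        using c BL1_range[OF h]
        by (intro outer_measure_of_superlevel_le[OF assms(1), where b = 1]) (auto simp: h_def)
      ultimately have "outer_measure_of (M k) {\<omega> \<in> space (M k). K < norm (X k \<omega>)} \<le> ennreal (e / 2)"
        by (meson ennreal_leI order_trans)
      also have "\<dots> < ennreal e" using \<open>0 < e\<close> by (simp add: ennreal_lessI)
      finally show ?case .
    qed
  qed
qed

text \<open>If the suprema do not tend to 0, they are at least some \<open>e > 0\<close> at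
  infinitely many indices; enumerating these and picking almost maximal \<open>P\<close> gives a
  sequence with no subsequence tending to 0. Indices below \<open>m\<close> are discarded because
  the properties needed later hold only eventually.\<close>

lemma SUP_tendsto_0_if_subsequences:
  fixes f :: "nat \<Rightarrow> 'p \<Rightarrow> ennreal"
    and m :: nat
  assumes "\<And>(\<sigma> :: nat \<Rightarrow> nat) p. strict_mono \<sigma> \<Longrightarrow> (\<And>k. m \<le> \<sigma> k) \<Longrightarrow> (\<And>k. p k \<in> \<P> (\<sigma> k)) \<Longrightarrow>
    \<exists>s. strict_mono s \<and> (\<lambda>k. f (\<sigma> (s k)) (p (s k))) \<longlonglongrightarrow> 0"
  shows "(\<lambda>n. SUP P\<in>\<P> n. f n P) \<longlonglongrightarrow> 0"
proof (rule tendsto_zero_ennreal, rule ccontr)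
  fix e :: real assume "0 < e" and "\<not> (\<forall>\<^sub>F n in sequentially. (SUP P\<in>\<P> n. f n P) < ennreal e)"
  then have inf: "infinite {n. ennreal e \<le> (SUP P\<in>\<P> n. f n P)}"
    by (simp add: eventually_sequentially infinite_nat_iff_unbounded_le not_less)
  define B where "B = {n. ennreal e \<le> (SUP P\<in>\<P> n. f n P)} - {..<m}"
  have "infinite B" unfolding B_def by (rule Diff_infinite_finite[OF _ inf]) simp
  define \<sigma> where "\<sigma> = enumerate B"
  have \<sigma>: "strict_mono \<sigma>" "\<And>k. \<sigma> k \<in> B"
    using \<open>infinite B\<close> unfolding \<sigma>_def by (auto simp: strict_mono_enumerate enumerate_in_set)
  \<comment> \<open>The supremum need not be attained, hence the loss from \<open>e\<close> to
    \<open>e / 2\<close>.\<close>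
  have "\<exists>P\<in>\<P> (\<sigma> k). ennreal (e / 2) < f (\<sigma> k) P" for k
  proof -
    have "ennreal (e / 2) < ennreal e" using \<open>0 < e\<close> by (simp add: ennreal_less_iff)
    also have "\<dots> \<le> (SUP P\<in>\<P> (\<sigma> k). f (\<sigma> k) P)" using \<sigma>(2)[of k] by (simp add: B_def)
    finally show ?thesis by (simp add: less_SUP_iff)
  qed
  then obtain p where p: "\<And>k. p k \<in> \<P> (\<sigma> k)" "\<And>k. ennreal (e / 2) < f (\<sigma> k) (p k)" by metis
  have "\<exists>s. strict_mono s \<and> (\<lambda>k. f (\<sigma> (s k)) (p (s k))) \<longlonglongrightarrow> 0"
  proof (rule assms[of \<sigma> p])
    show "m \<le> \<sigma> k" for k using \<sigma>(2)[of k] by (simp add: B_def)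
  qed (use \<sigma>(1) p(1) in auto)
  then obtain s where "(\<lambda>k. f (\<sigma> (s k)) (p (s k))) \<longlonglongrightarrow> 0" by blast
  then have "\<forall>\<^sub>F k in sequentially. f (\<sigma> (s k)) (p (s k)) < ennreal (e / 2)"
    using \<open>0 < e\<close> by (intro order_tendstoD) auto
  then obtain k where "f (\<sigma> (s k)) (p (s k)) < ennreal (e / 2)"
    by (auto dest: eventually_happens)
  with p(2)[of "s k"] show False by simp
qed

theorem theoremB3:
  fixes \<phi> :: "'d::real_normed_vector \<Rightarrow> 'e::real_normed_vector"
    and \<phi>' :: "'d \<Rightarrow> 'd \<Rightarrow> 'e"
    and Dphi Drho D0 :: "'d set"
    and drho :: "'d \<Rightarrow> 'd \<Rightarrow> real"
    and \<P> :: "nat \<Rightarrow> 'p set"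
    and M :: "nat \<Rightarrow> 'p \<Rightarrow> 'w measure"
    and N :: "'p \<Rightarrow> 'v measure"
    and \<rho>hat :: "nat \<Rightarrow> 'p \<Rightarrow> 'w \<Rightarrow> 'd"
    and \<rho> :: "'p \<Rightarrow> 'd"
    and Z :: "'p \<Rightarrow> 'v \<Rightarrow> 'd"
    and r :: "nat \<Rightarrow> real"
    and n0 :: nat
  assumes "subspace D0"
    and "Drho \<subseteq> Dphi"
    and "Metric_space Drho drho"
    and "compact_space (Metric_space.mtopology Drho drho)"
    and "hadamard_differentiable_uniformly Dphi Drho drho D0 \<phi> \<phi>'"
    and "\<And>n P. n \<ge> n0 \<Longrightarrow> P \<in> \<P> n \<Longrightarrow> prob_space (M n P)"
    and "\<And>n P. n \<ge> n0 \<Longrightarrow> P \<in> \<P> n \<Longrightarrow> \<rho>hat n P \<in> space (M n P) \<rightarrow> Dphi"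
    and "\<And>P. P \<in> (\<Union>n\<in>{n0..}. \<P> n) \<Longrightarrow> \<rho> P \<in> Drho"
    and "filterlim r at_top sequentially"
    and "\<And>P. P \<in> (\<Union>n\<in>{n0..}. \<P> n) \<Longrightarrow> prob_space (N P)"
    and "weak_conv_uniformly M (\<lambda>n P \<omega>. r n *\<^sub>R (\<rho>hat n P \<omega> - \<rho> P)) N Z \<P>"
    and "\<And>P. P \<in> (\<Union>n\<in>{n0..}. \<P> n) \<Longrightarrow> separable_random_element (N P) (Z P)"
    and "\<And>P. P \<in> (\<Union>n\<in>{n0..}. \<P> n) \<Longrightarrow> Z P \<in> space (N P) \<rightarrow> D0"
    and "weakly_relatively_compact D0 (\<Union>n\<in>{n0..}. \<P> n) N Z"
  shows "weak_conv_uniformly M (\<lambda>n P \<omega>. r n *\<^sub>R (\<phi> (\<rho>hat n P \<omega>) - \<phi> (\<rho> P)))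
           N (\<lambda>P \<omega>. \<phi>' (\<rho> P) (Z P \<omega>)) \<P> \<and>
         (continuous_map (prod_topology (Metric_space.mtopology Drho drho) euclidean) euclidean
            (\<lambda>(q, h). \<phi>' q h) \<longrightarrow>
          outer_prob_null_uniformly M
            (\<lambda>n P \<omega>. r n *\<^sub>R (\<phi> (\<rho>hat n P \<omega>) - \<phi> (\<rho> P))
                        - \<phi>' (\<rho> P) (r n *\<^sub>R (\<rho>hat n P \<omega> - \<rho> P))) \<P>) \<and>
         weakly_relatively_compact UNIV (\<Union>n\<in>{n0..}. \<P> n) N (\<lambda>P \<omega>. \<phi>' (\<rho> P) (Z P \<omega>))"
proof -
  interpret rho: Metric_space Drho drho by fact
  let ?T = "rho.mtopology" and ?\<Q> = "\<Union>n\<in>{n0..}. \<P> n"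
  define X where "X n P \<omega> = r n *\<^sub>R (\<rho>hat n P \<omega> - \<rho> P)" for n P \<omega>
  define W where "W P \<omega> = \<phi>' (\<rho> P) (Z P \<omega>)" for P \<omega>
  \<comment> \<open>The rescaled increment as a deterministic map of the direction \<open>y\<close>,
    with \<open>D n P\<close> the admissible directions. Inserting \<open>X n P\<close> recovers the
    estimator only if \<open>r n \<noteq> 0\<close>, because \<open>inverse 0 = 0\<close>.\<close>
  define Q where "Q n P y = r n *\<^sub>R (\<phi> (\<rho> P + inverse (r n) *\<^sub>R y) - \<phi> (\<rho> P))" for n P y
  define D where "D n P = {y. \<rho> P + inverse (r n) *\<^sub>R y \<in> Dphi}" for n P

  \<comment> \<open>Continuity of the derivative and measurability of the limits\<close>
  note had = assms(5)[unfolded hadamard_differentiable_uniformly_def]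
  have deriv_cont: "(\<lambda>k. \<phi>' (\<rho>s k) (hs k)) \<longlonglongrightarrow> \<phi>' q h"
    if "\<And>k. \<rho>s k \<in> Drho" "limitin ?T \<rho>s q sequentially" "\<And>k. hs k \<in> D0" "h \<in> D0" "hs \<longlonglongrightarrow> h"
    for \<rho>s q hs h
    using had that by (auto simp: image_subset_iff)
  \<comment> \<open>A constant parameter sequence in the joint continuity requirement.\<close>
  have cont: "continuous_on D0 (\<phi>' q)" if "q \<in> Drho" for q
    unfolding continuous_on_sequentially using deriv_cont[of "\<lambda>_. q" q] that by (auto simp: o_def)
  have Z_meas: "Z P \<in> measurable (N P) (restrict_space borel D0)" if "P \<in> ?\<Q>" for P
    using assms(14) that unfolding weakly_relatively_compact_def by blast
  have W_meas: "W P \<in> borel_measurable (N P)" if "P \<in> ?\<Q>" for P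
    unfolding W_def
    using measurable_compose[OF Z_meas[OF that] borel_measurable_continuous_on_restrict[OF cont[OF assms(8)[OF that]]]] .

  \<comment> \<open>Convergent subsequences of limit processes and parameters\<close>
  have subsequence: "\<exists>s L q. strict_mono s \<and> prob_space L \<and> sets L = sets (restrict_space borel D0) \<and>
      (\<lambda>k. BL_deviation D0 (N (p (s k))) (Z (p (s k))) L (\<lambda>x. x)) \<longlonglongrightarrow> 0 \<and> q \<in> Drho \<and>
      limitin ?T (\<lambda>k. \<rho> (p (s k))) q sequentially"
    if p: "\<And>k. p k \<in> ?\<Q>" for p :: "nat \<Rightarrow> 'p"
  proof -
    have "range p \<subseteq> ?\<Q>" using p by blast
    then obtain s L where s: "strict_mono s" "prob_space L" "sets L = sets (restrict_space borel D0)"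
      "(\<lambda>k. BL_deviation D0 (N (p (s k))) (Z (p (s k))) L (\<lambda>x. x)) \<longlonglongrightarrow> 0"
      using assms(14) unfolding weakly_relatively_compact_def by blast
    \<comment> \<open>A second extraction, now in the metric \<open>drho\<close>; weak convergence
      persists along \<open>s \<circ> t\<close>.\<close>
    have "range (\<lambda>k. \<rho> (p (s k))) \<subseteq> Drho" using assms(8) p by blast
    then obtain q t where t: "q \<in> Drho" "strict_mono t" "limitin ?T ((\<lambda>k. \<rho> (p (s k))) \<circ> t) q sequentially"
      using assms(4) unfolding rho.compact_space_sequentially by blast
    have "(\<lambda>k. BL_deviation D0 (N (p (s (t k)))) (Z (p (s (t k)))) L (\<lambda>x. x)) \<longlonglongrightarrow> 0"
      using LIMSEQ_subseq_LIMSEQ[OF s(4) t(2)] by (simp add: o_def)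
    with s t show ?thesis
      by (intro exI[of _ "s \<circ> t"] exI[of _ L] exI[of _ q]) (auto simp: o_def strict_mono_def)
  qed
  \<comment> \<open>The mapping lemma for the varying derivatives. Its domains are
    \<open>D0\<close>, where the \<open>Z\<close> take their values and where sequential continuity
    of the derivative is available.\<close>
  have W_lim: "(\<lambda>k. BL_deviation UNIV (N (p k)) (W (p k)) L (\<phi>' q)) \<longlonglongrightarrow> 0"
    if p: "\<And>k. p k \<in> ?\<Q>" and L: "prob_space L" "sets L = sets (restrict_space borel D0)"
      and dev: "(\<lambda>k. BL_deviation UNIV (N (p k)) (Z (p k)) L (\<lambda>x. x)) \<longlonglongrightarrow> 0"
      and q: "q \<in> Drho" "limitin ?T (\<lambda>k. \<rho> (p k)) q sequentially"
    for p :: "nat \<Rightarrow> 'p" and L q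
    unfolding W_def
  proof (rule extended_continuous_mapping_BL[where D = "\<lambda>_. D0" and S = D0, OF _ L _ dev cont[OF q(1)]])
    show "prob_space (N (p k))" for k using assms(10) p by blast
    show "Z (p k) \<in> space (N (p k)) \<rightarrow> D0" for k using assms(13) p by blast
    show "(\<lambda>k. \<phi>' (\<rho> (p (\<sigma> k))) (y k)) \<longlonglongrightarrow> \<phi>' q x"
      if "filterlim \<sigma> at_top sequentially" "\<And>k. y k \<in> D0" "x \<in> D0" "y \<longlonglongrightarrow> x" for \<sigma> y x
      using that assms(8)[OF p] limitin_compose[OF q(2) that(1)] by (intro deriv_cont) auto
  qed
  \<comment> \<open>Relative compactness is given in \<open>D0\<close>, whereas the rescaled
    estimators live in the whole space.\<close>
  have to_UNIV: "(\<lambda>k. BL_deviation UNIV (N (p k)) (Z (p k)) L (\<lambda>x. x)) \<longlonglongrightarrow> 0"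
    if "(\<lambda>k. BL_deviation D0 (N (p k)) (Z (p k)) L (\<lambda>x. x)) \<longlonglongrightarrow> 0" for p :: "nat \<Rightarrow> 'p" and L
    by (rule tendsto_sandwich[OF _ _ tendsto_const that]) (auto intro!: always_eventually BL_deviation_mono)

  \<comment> \<open>Continuous convergence of the rescaled increments\<close>
  obtain n1 where n1: "n0 \<le> n1" "\<And>n. n1 \<le> n \<Longrightarrow> 0 < r n"
  proof -
    have "\<forall>\<^sub>F n in sequentially. n0 \<le> n \<and> 0 < r n"
      using assms(9) by (intro eventually_conj eventually_ge_at_top) (auto simp: filterlim_at_top_dense)
    then show ?thesis using that unfolding eventually_sequentially by blast
  qed
  have Q_X: "r n *\<^sub>R (\<phi> (\<rho>hat n P \<omega>) - \<phi> (\<rho> P)) = Q n P (X n P \<omega>)" if "n1 \<le> n" for n P \<omega>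
    using n1(2)[OF that] by (simp add: Q_def X_def)
  have Q_lim: "(\<lambda>k. Q (\<sigma> k) (p k) (y k)) \<longlonglongrightarrow> \<phi>' q x"
    if "filterlim \<sigma> at_top sequentially" "\<And>k. n1 \<le> \<sigma> k" "\<And>k. p k \<in> \<P> (\<sigma> k)"
      "limitin ?T (\<lambda>k. \<rho> (p k)) q sequentially" "\<And>k. y k \<in> D (\<sigma> k) (p k)" "x \<in> D0" "y \<longlonglongrightarrow> x"
    for \<sigma> p q y x
  proof -
    \<comment> \<open>Differentiability is applied with step
      \<open>t k = inverse (r (\<sigma> k))\<close>, nonzero from \<open>n1\<close> on; dividing by
      it is multiplying by \<open>r (\<sigma> k)\<close>.\<close>
    have "(\<lambda>k. inverse (r (\<sigma> k))) \<longlonglongrightarrow> 0"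
      using filterlim_compose[OF assms(9) that(1)] by (rule tendsto_inverse_0_at_top)
    moreover have "inverse (r (\<sigma> k)) \<noteq> 0" for k using n1(2)[OF that(2)[of k]] by simp
    moreover have "range (\<lambda>k. \<rho> (p k)) \<subseteq> Drho"
      using assms(8) that(2,3) n1(1) by (blast intro: order_trans)
    moreover have "\<rho> (p k) + inverse (r (\<sigma> k)) *\<^sub>R y k \<in> Dphi" for k
      using that(5)[of k] by (simp add: D_def)
    ultimately have "(\<lambda>k. (\<phi> (\<rho> (p k) + inverse (r (\<sigma> k)) *\<^sub>R y k) - \<phi> (\<rho> (p k))) /\<^sub>R inverse (r (\<sigma> k)))
        \<longlonglongrightarrow> \<phi>' q x"
      using that(4,6,7) by (intro conjunct1[OF conjunct2[OF had], rule_format]) auto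
    then show ?thesis by (simp add: Q_def)
  qed
  have joint_subsequence: "\<exists>s L q. strict_mono s \<and> prob_space L \<and> sets L = sets (restrict_space borel D0) \<and>
      (\<lambda>k. BL_deviation UNIV (N (p (s k))) (W (p (s k))) L (\<phi>' q)) \<longlonglongrightarrow> 0 \<and> q \<in> Drho \<and>
      limitin ?T (\<lambda>k. \<rho> (p (s k))) q sequentially \<and>
      (\<lambda>k. BL_deviation UNIV (M (\<sigma> (s k)) (p (s k))) (X (\<sigma> (s k)) (p (s k))) L (\<lambda>x. x)) \<longlonglongrightarrow> 0"
    if \<sigma>: "strict_mono \<sigma>" "\<And>k. n1 \<le> \<sigma> k" "\<And>k. p k \<in> \<P> (\<sigma> k)" for \<sigma> :: "nat \<Rightarrow> nat" and p :: "nat \<Rightarrow> 'p"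
  proof -
    have pQ: "p k \<in> ?\<Q>" for k using \<sigma>(2,3)[of k] n1(1) by (auto intro: order_trans)
    obtain s L q where s: "strict_mono s" "prob_space L" "sets L = sets (restrict_space borel D0)"
      "(\<lambda>k. BL_deviation D0 (N (p (s k))) (Z (p (s k))) L (\<lambda>x. x)) \<longlonglongrightarrow> 0" "q \<in> Drho"
      "limitin ?T (\<lambda>k. \<rho> (p (s k))) q sequentially"
      using subsequence[of p, OF pQ] by blast
    note dev = to_UNIV[of "\<lambda>k. p (s k)", OF s(4)]
    \<comment> \<open>Uniformity allows \<open>P\<close> to vary with the index: the supremum
      dominates the deviation at \<open>p (s k)\<close>, and adding the deviation of
      \<open>Z\<close> from \<open>L\<close> makes \<open>X\<close> converge to \<open>L\<close> as
      well.\<close>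
    have "(\<lambda>n. SUP P\<in>\<P> n. BL_deviation UNIV (M n P) (X n P) (N P) (Z P)) \<longlonglongrightarrow> 0"
      using assms(11) unfolding weak_conv_uniformly_def X_def by blast
    from LIMSEQ_subseq_LIMSEQ[OF this strict_mono_o[OF \<sigma>(1) s(1)]]
    have sum: "(\<lambda>k. (SUP P\<in>\<P> (\<sigma> (s k)). BL_deviation UNIV (M (\<sigma> (s k)) P) (X (\<sigma> (s k)) P) (N P) (Z P))
        + BL_deviation UNIV (N (p (s k))) (Z (p (s k))) L (\<lambda>x. x)) \<longlonglongrightarrow> 0"
      using tendsto_add[OF _ dev] by (force simp: o_def)
    have le: "BL_deviation UNIV (M (\<sigma> (s k)) (p (s k))) (X (\<sigma> (s k)) (p (s k))) L (\<lambda>x. x)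
        \<le> (SUP P\<in>\<P> (\<sigma> (s k)). BL_deviation UNIV (M (\<sigma> (s k)) P) (X (\<sigma> (s k)) P) (N P) (Z P))
        + BL_deviation UNIV (N (p (s k))) (Z (p (s k))) L (\<lambda>x. x)" for k
    proof (rule order_trans[OF BL_deviation_triangle(1)])
      show "prob_space (N (p (s k)))" using assms(10)[OF pQ] .
      show "Z (p (s k)) \<in> borel_measurable (N (p (s k)))"
        using assms(12)[OF pQ] unfolding separable_random_element_def by blast
    qed (intro add_mono SUP_upper \<sigma>(3) order_refl)
    have "(\<lambda>k. BL_deviation UNIV (M (\<sigma> (s k)) (p (s k))) (X (\<sigma> (s k)) (p (s k))) L (\<lambda>x. x)) \<longlonglongrightarrow> 0"
      by (rule tendsto_sandwich[OF _ _ tendsto_const sum]) (simp_all add: le)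
    with s W_lim[of "\<lambda>k. p (s k)", OF pQ s(2,3) dev s(5,6)] show ?thesis by blast
  qed
  have M_prob: "prob_space (M n P)" and X_D: "X n P \<in> space (M n P) \<rightarrow> D n P"
    if "n1 \<le> n" "P \<in> \<P> n" for n P
  proof -
    have "n0 \<le> n" using n1(1) that(1) by simp
    then show "prob_space (M n P)" using assms(6) that(2) by blast
    have "\<rho>hat n P \<in> space (M n P) \<rightarrow> Dphi" using assms(7) that(2) \<open>n0 \<le> n\<close> by blast
    then show "X n P \<in> space (M n P) \<rightarrow> D n P"
      using n1(2)[OF that(1)] by (auto simp: X_def D_def)
  qed

  \<comment> \<open>Uniform weak convergence of the rescaled increments\<close>
  have "(\<lambda>n. SUP P\<in>\<P> n. BL_deviation UNIV (M n P) (\<lambda>\<omega>. r n *\<^sub>R (\<phi> (\<rho>hat n P \<omega>) - \<phi> (\<rho> P))) (N P) (W P)) \<longlonglongrightarrow> 0"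
  proof (rule SUP_tendsto_0_if_subsequences[where m = n1])
    fix \<sigma> :: "nat \<Rightarrow> nat" and p :: "nat \<Rightarrow> 'p"
    assume \<sigma>: "strict_mono \<sigma>" "\<And>k. n1 \<le> \<sigma> k" "\<And>k. p k \<in> \<P> (\<sigma> k)"
    obtain s L q where s: "strict_mono s" "prob_space L" "sets L = sets (restrict_space borel D0)"
      "(\<lambda>k. BL_deviation UNIV (N (p (s k))) (W (p (s k))) L (\<phi>' q)) \<longlonglongrightarrow> 0" "q \<in> Drho"
      "limitin ?T (\<lambda>k. \<rho> (p (s k))) q sequentially"
      "(\<lambda>k. BL_deviation UNIV (M (\<sigma> (s k)) (p (s k))) (X (\<sigma> (s k)) (p (s k))) L (\<lambda>x. x)) \<longlonglongrightarrow> 0"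
      using joint_subsequence[of \<sigma> p, OF \<sigma>] by blast
    have pQ: "p k \<in> ?\<Q>" for k using \<sigma>(2,3)[of k] n1(1) by (auto intro: order_trans)
    have "(\<lambda>k. BL_deviation UNIV (M (\<sigma> (s k)) (p (s k)))
        (\<lambda>\<omega>. Q (\<sigma> (s k)) (p (s k)) (X (\<sigma> (s k)) (p (s k)) \<omega>)) L (\<phi>' q)) \<longlonglongrightarrow> 0"
    proof (rule extended_continuous_mapping_BL[where S = D0 and D = "\<lambda>k. D (\<sigma> (s k)) (p (s k))",
          OF M_prob[OF \<sigma>(2,3)] s(2,3) X_D[OF \<sigma>(2,3)] s(7) cont[OF s(5)]])
      show "(\<lambda>k. Q (\<sigma> (s (\<tau> k))) (p (s (\<tau> k))) (y k)) \<longlonglongrightarrow> \<phi>' q x"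
        if "filterlim \<tau> at_top sequentially" "\<And>k. y k \<in> D (\<sigma> (s (\<tau> k))) (p (s (\<tau> k)))" "x \<in> D0" "y \<longlonglongrightarrow> x"
        for \<tau> y x
        using that \<sigma>(2,3) limitin_compose[OF s(6) that(1)]
          filterlim_compose[OF filterlim_subseq[OF \<sigma>(1)] filterlim_compose[OF filterlim_subseq[OF s(1)] that(1)]]
        by (intro Q_lim) auto
    qed
    \<comment> \<open>The increments and \<open>W\<close> both converge to \<open>\<phi>' q\<close>
      under \<open>L\<close>; the second triangle inequality compares them through this common
      limit.\<close>
    note sum = tendsto_add[OF this s(4), unfolded add_0]
    have "(\<lambda>k. BL_deviation UNIV (M (\<sigma> (s k)) (p (s k)))
        (\<lambda>\<omega>. Q (\<sigma> (s k)) (p (s k)) (X (\<sigma> (s k)) (p (s k)) \<omega>)) (N (p (s k))) (W (p (s k)))) \<longlonglongrightarrow> 0"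
      by (rule tendsto_sandwich[OF _ _ tendsto_const sum])
        (simp_all add: BL_deviation_triangle(2)[OF assms(10)[OF pQ] W_meas[OF pQ]])
    then show "\<exists>s. strict_mono s \<and> (\<lambda>k. BL_deviation UNIV (M (\<sigma> (s k)) (p (s k)))
        (\<lambda>\<omega>. r (\<sigma> (s k)) *\<^sub>R (\<phi> (\<rho>hat (\<sigma> (s k)) (p (s k)) \<omega>) - \<phi> (\<rho> (p (s k))))) (N (p (s k))) (W (p (s k)))) \<longlonglongrightarrow> 0"
      using s(1) by (auto simp: Q_X[OF \<sigma>(2)])
  qed
  moreover have "\<forall>\<^sub>F n in sequentially. \<forall>P\<in>\<P> n. W P \<in> borel_measurable (N P)"
    using eventually_ge_at_top[of n0] by eventually_elim (auto intro!: W_meas)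
  ultimately have 1: "weak_conv_uniformly M (\<lambda>n P \<omega>. r n *\<^sub>R (\<phi> (\<rho>hat n P \<omega>) - \<phi> (\<rho> P))) N W \<P>"
    unfolding weak_conv_uniformly_def by blast

  \<comment> \<open>The remainder in outer probability\<close>
  have 2: "outer_prob_null_uniformly M
      (\<lambda>n P \<omega>. r n *\<^sub>R (\<phi> (\<rho>hat n P \<omega>) - \<phi> (\<rho> P)) - \<phi>' (\<rho> P) (X n P \<omega>)) \<P>"
    if jc: "continuous_map (prod_topology ?T euclidean) euclidean (\<lambda>(q, h). \<phi>' q h)"
    unfolding outer_prob_null_uniformly_def
  proof (intro allI impI SUP_tendsto_0_if_subsequences[where m = n1])
    fix K :: real and \<sigma> :: "nat \<Rightarrow> nat" and p :: "nat \<Rightarrow> 'p"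
    assume "0 < K" and \<sigma>: "strict_mono \<sigma>" "\<And>k. n1 \<le> \<sigma> k" "\<And>k. p k \<in> \<P> (\<sigma> k)"
    obtain s L q where s: "strict_mono s" "prob_space L" "sets L = sets (restrict_space borel D0)"
      "limitin ?T (\<lambda>k. \<rho> (p (s k))) q sequentially"
      "(\<lambda>k. BL_deviation UNIV (M (\<sigma> (s k)) (p (s k))) (X (\<sigma> (s k)) (p (s k))) L (\<lambda>x. x)) \<longlonglongrightarrow> 0"
      using joint_subsequence[of \<sigma> p, OF \<sigma>] by blast
    define R where "R k y = Q (\<sigma> (s k)) (p (s k)) y - \<phi>' (\<rho> (p (s k))) y" for k y
    have "(\<lambda>k. BL_deviation UNIV (M (\<sigma> (s k)) (p (s k)))
        (\<lambda>\<omega>. R k (X (\<sigma> (s k)) (p (s k)) \<omega>)) L (\<lambda>_. 0)) \<longlonglongrightarrow> 0"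
    proof (rule extended_continuous_mapping_BL[where S = D0 and D = "\<lambda>k. D (\<sigma> (s k)) (p (s k))",
          OF M_prob[OF \<sigma>(2,3)] s(2,3) X_D[OF \<sigma>(2,3)] s(5) continuous_on_const])
      \<comment> \<open>Only the limit \<open>x\<close> lies in \<open>D0\<close>, while the
        \<open>y k\<close> may lie outside it; so the derivative term calls for the joint continuity
        \<open>jc\<close> on the whole space.\<close>
      fix \<tau> y x
      assume \<tau>: "filterlim \<tau> at_top sequentially" "\<And>k. y k \<in> D (\<sigma> (s (\<tau> k))) (p (s (\<tau> k)))" "x \<in> D0" "y \<longlonglongrightarrow> x"
      note lim = limitin_compose[OF s(4) \<tau>(1)]
      have "(\<lambda>k. Q (\<sigma> (s (\<tau> k))) (p (s (\<tau> k))) (y k)) \<longlonglongrightarrow> \<phi>' q x"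
        using \<tau> \<sigma>(2,3) lim
          filterlim_compose[OF filterlim_subseq[OF \<sigma>(1)] filterlim_compose[OF filterlim_subseq[OF s(1)] \<tau>(1)]]
        by (intro Q_lim) auto
      from tendsto_diff[OF this continuous_map_prod_tendsto[OF jc lim \<tau>(4)]]
      show "(\<lambda>k. R (\<tau> k) (y k)) \<longlonglongrightarrow> 0" by (simp add: R_def)
    qed
    from outer_prob_tendsto_0_if_BL_deviation[OF M_prob[OF \<sigma>(2,3)] this \<open>0 < K\<close>]
    show "\<exists>s. strict_mono s \<and> (\<lambda>k. outer_measure_of (M (\<sigma> (s k)) (p (s k)))
        {\<omega> \<in> space (M (\<sigma> (s k)) (p (s k))). K < norm (r (\<sigma> (s k)) *\<^sub>R (\<phi> (\<rho>hat (\<sigma> (s k)) (p (s k)) \<omega>) - \<phi> (\<rho> (p (s k))))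
          - \<phi>' (\<rho> (p (s k))) (X (\<sigma> (s k)) (p (s k)) \<omega>))}) \<longlonglongrightarrow> 0"
      using s(1) by (auto simp: Q_X[OF \<sigma>(2)] R_def)
  qed

  \<comment> \<open>Relative compactness of the transformed limits\<close>
  have 3: "weakly_relatively_compact UNIV ?\<Q> N W"
    unfolding weakly_relatively_compact_def
  proof (intro conjI ballI allI impI)
    show "W P \<in> measurable (N P) (restrict_space borel UNIV)" if "P \<in> ?\<Q>" for P
      using W_meas[OF that] by simp
    fix p :: "nat \<Rightarrow> 'p" assume "range p \<subseteq> ?\<Q>"
    then have p: "p k \<in> ?\<Q>" for k by blast
    obtain s L q where s: "strict_mono s" "prob_space L" "sets L = sets (restrict_space borel D0)"
      "(\<lambda>k. BL_deviation D0 (N (p (s k))) (Z (p (s k))) L (\<lambda>x. x)) \<longlonglongrightarrow> 0" "q \<in> Drho"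
      "limitin ?T (\<lambda>k. \<rho> (p (s k))) q sequentially"
      using subsequence[of p, OF p] by blast
    have meas: "\<phi>' q \<in> borel_measurable L"
      by (rule borel_measurable_subspace[OF s(3) cont[OF s(5)]])
    \<comment> \<open>The definition wants a limit law carried by the identity map, so
      \<open>\<phi>' q\<close> under \<open>L\<close> is replaced by its push-forward.\<close>
    have "BL_deviation UNIV (N P) (W P) (distr L borel (\<phi>' q)) (\<lambda>x. x) = BL_deviation UNIV (N P) (W P) L (\<phi>' q)" for P
      unfolding BL_deviation_def
      by (intro SUP_cong refl) (simp add: integral_distr[OF meas BL1_UNIV_measurable])
    then show "\<exists>s. strict_mono s \<and> (\<exists>L. prob_space L \<and> sets L = sets (restrict_space borel UNIV) \<and>
        (\<lambda>k. BL_deviation UNIV (N (p (s k))) (W (p (s k))) L (\<lambda>x. x)) \<longlonglongrightarrow> 0)"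
      using W_lim[of "\<lambda>k. p (s k)", OF p s(2,3) to_UNIV[of "\<lambda>k. p (s k)", OF s(4)] s(5,6)] s(1) prob_space.prob_space_distr[OF s(2) meas]
      by (intro exI[of _ s] conjI exI[of _ "distr L borel (\<phi>' q)"]) simp_all
  qed
  show ?thesis using 1 2 3 unfolding W_def X_def by blast
qed

end
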